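(* Assume the support margin assumption (with constant $\beta\in(0,1)$) and the covering/Lipschitz assumption given in the context. Let $\hat\theta\in\operatorname{argmin}_{\theta\in\Theta}\hat L_{PL}(\theta)$. Then for every $\epsilon>0$ and $\delta\in(0,1)$, with probability at least $1-\delta$, $$D_{TV}(p_{\hat\theta},p_{\mathcal{X}})<\sqrt{\tfrac12\,\bar C_{AT}(p_{\hat\theta})\Big(\hat L_{PL}(\hat\theta)+B\ln\tfrac1\beta+\epsilon\Big)}+C,$$ where $$B=\sqrt{\frac{2^{3N}|\Omega|^NC_\epsilon(\Theta)}{m\,\delta}}+\sqrt{\frac{\ln\frac{8C_\epsilon(\Theta)}{\delta}}{2n}},\qquad C=\sqrt{\frac{|\Omega|^{3N}}{8\delta n}}.$$
   Context: $\Omega$ is a finite set, $\mathcal{X}=\Omega^N$, $p_{\mathcal{X}}$ a probability distribution on $\mathcal{X}$, $\{p_\theta\}_{\theta\in\Theta}$ a family of distributions on $\mathcal{X}$. For $K\subseteq[N]$, $x_K=(x_i)_{i\in K}$, $x_{-K}=(x_i)_{i\notin K}$. $\mathcal{K}$ is a collection of subsets (masks) of $[N]$, and for each $x\in\mathcal{X}$, $p_{\mathcal{K}}(\cdot\mid x)$ is a fixed probability distribution on $\mathcal{K}$. For any distribution $q$ on $\mathcal{X}$, $$q(x_K\mid x_{-K},K)=\frac{q(x)\,p_{\mathcal{K}}(K\mid x)}{\sum_{x'_K}q(x'_K,x_{-K})\,p_{\mathcal{K}}(K\mid(x'_K,x_{-K}))}.$$ Data: $X^{(1)},\dots,X^{(n)}$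 i.i.d. from $p_{\mathcal{X}}$ and, for each $i$, masks $K^{(i)}_1,\dots,K^{(i)}_m$ i.i.d. from $p_{\mathcal{K}}(\cdot\mid X^{(i)})$. Empirical loss: $\hat L_{PL}(\theta)=\frac1{nm}\sum_{i=1}^n\sum_{j=1}^m-\log p_\theta(X^{(i)}_{K^{(i)}_j}\mid X^{(i)}_{-K^{(i)}_j},K^{(i)}_j)$. Logarithms are natural; $D_{TV}(p,q)=\frac12\sum_x|p(x)-q(x)|$. Block approximate tensorization of entropy: $\bar C_{AT}(q)$ is a constant such that for every distribution $r$ on $\mathcal{X}$, $D_{KL}(r,q)\le\bar C_{AT}(q)\,\mathbb{E}_{X\sim r}\mathbb{E}_{K\sim p_{\mathcal{K}}(\cdot\mid X)}[D_{KL}(r(\cdot\mid X_{-K},K),q(\cdot\mid X_{-K},K))]$, where $D_{KL}(r,q)=\sum_x r(x)\ln\frac{r(x)}{q(x)}$. Support margin assumption: there is $\beta\in(0,1)$ such that for all $X\in\mathcal{X}$, $K\subseteq[N]$, $\theta\in\Theta$: if $p_{\mathcal{X}}(X_K\mid X_{-K},K)>0$ then $p_\theta(X_K\mid X_{-K},K)\ge\beta$. Covering/Lipschitz assumption: for every $\epsilon>0$ there is a finite partition $\{\Theta_1,\Theta_2,\dots\}$ of $\Theta$ such that for every $i$, all $\theta_1,\theta_2\in\Theta_i$ and all $(X,K)\in\mathcal{X}\times\mathcal{K}$, $|\log p_{\theta_1}(X_K\mid X_{-K},K)-\log p_{\theta_2}(X_K\mid X_{-K},K)|\le\epsilon/2$.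 $C_\epsilon(\Theta)$ is the smallest cardinality of such a partition. *)

theory Defs
  imports "HOL-Probability.Probability" "HOL-Library.Disjoint_Sets"
begin

text \<open>
  The alphabet is a finite type \<open>'a\<close>, the positions are a finite type \<open>'n\<close> (so \<open>CARD('n)\<close> is the
  sequence length), a sequence is a function \<open>'n \<Rightarrow> 'a\<close> and a mask is a set of positions.
\<close>

text \<open>
  The partial assignments \<open>x'\<^sub>K\<close> are represented by the full sequences \<open>(x'\<^sub>K, x\<^sub>-\<^sub>K)\<close>, i.e.\ those that
  agree with \<open>x\<close> outside \<open>K\<close>.
\<close>

definition completions :: "'n set \<Rightarrow> ('n \<Rightarrow> 'a) \<Rightarrow> ('n \<Rightarrow> 'a) set" where
  "completions K x = {x'. \<forall>i. i \<notin> K \<longrightarrow> x' i = x i}"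

text \<open>
  \<open>cond_prob pK q K x\<close> is \<open>q(x\<^sub>K | x\<^sub>-\<^sub>K, K)\<close>, where \<open>pK x\<close> is the mask distribution given \<open>x\<close>.  If the
  conditioning event has probability zero, the value is 0.
\<close>

definition cond_prob ::
  "(('n::finite \<Rightarrow> 'a::finite) \<Rightarrow> 'n set pmf) \<Rightarrow> ('n \<Rightarrow> 'a) pmf \<Rightarrow> 'n set \<Rightarrow> ('n \<Rightarrow> 'a) \<Rightarrow> real" where
  "cond_prob pK q K x =
     pmf q x * pmf (pK x) K / (\<Sum>x'\<in>completions K x. pmf q x' * pmf (pK x') K)"

definition tv_dist :: "'b::finite pmf \<Rightarrow> 'b pmf \<Rightarrow> real" where
  "tv_dist p q = (1/2) * (\<Sum>x\<in>UNIV. \<bar>pmf p x - pmf q x\<bar>)"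

text \<open>
  The divergence of mass functions on a finite set \<open>A\<close> takes values in the extended reals, since it is
  infinite without absolute continuity (the real-valued \<open>KL_divergence\<close> of the library is not
  meaningful in that case).  In the finite case \<open>0 ln 0 = 0\<close> holds automatically.
\<close>

definition kl_div :: "'b set \<Rightarrow> ('b \<Rightarrow> real) \<Rightarrow> ('b \<Rightarrow> real) \<Rightarrow> ereal" where
  "kl_div A r q =
     (if \<forall>x\<in>A. q x = 0 \<longrightarrow> r x = 0 then ereal (\<Sum>x\<in>A. r x * ln (r x / q x)) else \<infinity>)"

text \<open>
  \<open>q\<close> satisfies block approximate tensorization of entropy with constant \<open>c\<close>.  The distributions
  \<open>r(\<cdot> | x\<^sub>-\<^sub>K, K)\<close> and \<open>q(\<cdot> | x\<^sub>-\<^sub>K, K)\<close> live on \<open>completions K x\<close>.  Pairs \<open>(x, K)\<close> of probability zero do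
  not contribute, because \<open>0 * \<infinity> = 0\<close> in \<open>ereal\<close>.  A negative \<open>c\<close> could satisfy the inequality only if
  there is just one sequence; it is excluded because the square root of \<open>c\<close> is taken later on.
\<close>

definition block_approx_tensorization ::
  "(('n::finite \<Rightarrow> 'a::finite) \<Rightarrow> 'n set pmf) \<Rightarrow> ('n \<Rightarrow> 'a) pmf \<Rightarrow> real \<Rightarrow> bool" where
  "block_approx_tensorization pK q c \<longleftrightarrow>
     0 \<le> c \<and>
     (\<forall>r. kl_div UNIV (pmf r) (pmf q) \<le>
        ereal c * (\<Sum>x\<in>UNIV. ereal (pmf r x) * (\<Sum>K\<in>UNIV. ereal (pmf (pK x) K) *
          kl_div (completions K x) (cond_prob pK r K) (cond_prob pK q K))))"

definition support_margin ::
  "(('n::finite \<Rightarrow> 'a::finite) \<Rightarrow> 'n set pmf) \<Rightarrow> ('n \<Rightarrow> 'a) pmf \<Rightarrow>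
     ('t \<Rightarrow> ('n \<Rightarrow> 'a) pmf) \<Rightarrow> 't set \<Rightarrow> real \<Rightarrow> bool" where
  "support_margin pK pX p \<Theta> \<beta> \<longleftrightarrow>
     (\<forall>x K. \<forall>\<theta>\<in>\<Theta>. cond_prob pK pX K x > 0 \<longrightarrow> cond_prob pK (p \<theta>) K x \<ge> \<beta>)"

text \<open>
  \<open>|log a - log b| \<le> e\<close> for \<open>a, b \<ge> 0\<close>, where \<open>log 0 = -\<infinity>\<close>: exactly one infinite logarithm means
  infinite distance, two infinite logarithms count as equal (recall \<open>ln 0 = 0\<close> in HOL).
\<close>

definition log_close :: "real \<Rightarrow> real \<Rightarrow> real \<Rightarrow> bool" where
  "log_close e a b \<longleftrightarrow> (a = 0 \<longleftrightarrow> b = 0) \<and> \<bar>ln a - ln b\<bar> \<le> e"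

definition covering_partition ::
  "(('n::finite \<Rightarrow> 'a::finite) \<Rightarrow> 'n set pmf) \<Rightarrow> 'n set set \<Rightarrow>
     ('t \<Rightarrow> ('n \<Rightarrow> 'a) pmf) \<Rightarrow> 't set \<Rightarrow> real \<Rightarrow> 't set set \<Rightarrow> bool" where
  "covering_partition pK \<K> p \<Theta> \<epsilon> P \<longleftrightarrow>
     finite P \<and> partition_on \<Theta> P \<and>
     (\<forall>T\<in>P. \<forall>\<theta>1\<in>T. \<forall>\<theta>2\<in>T. \<forall>x. \<forall>K\<in>\<K>.
        log_close (\<epsilon> / 2) (cond_prob pK (p \<theta>1) K x) (cond_prob pK (p \<theta>2) K x))"

definition covering_number ::
  "(('n::finite \<Rightarrow> 'a::finite) \<Rightarrow> 'n set pmf) \<Rightarrow> 'n set set \<Rightarrow>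
     ('t \<Rightarrow> ('n \<Rightarrow> 'a) pmf) \<Rightarrow> 't set \<Rightarrow> real \<Rightarrow> nat" where
  "covering_number pK \<K> p \<Theta> \<epsilon> = (LEAST k. \<exists>P. covering_partition pK \<K> p \<Theta> \<epsilon> P \<and> card P = k)"

text \<open>
  A data set \<open>D\<close> maps \<open>i < n\<close> to the pair of the sequence \<open>fst (D i)\<close> and its masks \<open>snd (D i) j\<close>, \<open>j < m\<close>.
\<close>

type_synonym ('n, 'a) dataset = "nat \<Rightarrow> ('n \<Rightarrow> 'a) \<times> (nat \<Rightarrow> 'n set)"

definition data_pmf ::
  "(('n \<Rightarrow> 'a) \<Rightarrow> 'n set pmf) \<Rightarrow> ('n \<Rightarrow> 'a) pmf \<Rightarrow> nat \<Rightarrow> nat \<Rightarrow> ('n, 'a) dataset pmf" where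
  "data_pmf pK pX n m =
     Pi_pmf {..<n} undefined (\<lambda>_.
       bind_pmf pX (\<lambda>x. map_pmf (Pair x) (Pi_pmf {..<m} undefined (\<lambda>_. pK x))))"

text \<open>
  The support margin property makes every conditional probability in this sum positive for all data
  sets in the support of \<open>data_pmf\<close>, so the HOL value \<open>ln 0 = 0\<close> plays no role there.
\<close>

definition empirical_loss ::
  "(('n::finite \<Rightarrow> 'a::finite) \<Rightarrow> 'n set pmf) \<Rightarrow> ('t \<Rightarrow> ('n \<Rightarrow> 'a) pmf) \<Rightarrow> nat \<Rightarrow> nat \<Rightarrow>
     ('n, 'a) dataset \<Rightarrow> 't \<Rightarrow> real" where
  "empirical_loss pK p n m D \<theta> =
     1 / (real n * real m) *
       (\<Sum>i<n. \<Sum>j<m. - ln (cond_prob pK (p \<theta>) (snd (D i) j) (fst (D i))))"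

end

theory Submission
  imports Defs
begin

text \<open>
  Write \<open>r\<close> for the empirical distribution of the sequences in the data.  The triangle inequality gives
  \<open>TV(p\<^sub>\<theta>, p\<^sub>X) \<le> TV(p\<^sub>\<theta>, r) + TV(r, p\<^sub>X)\<close>.  For the first term, Pinsker's inequality and
  tensorization applied to \<open>r\<close> leave an averaged conditional divergence, which is at most the loss
  averaged over all masks of the observed sequences.  Given the sequences, the masks are independent, so
  Hoeffding's inequality and a union bound over one representative per cell of the partition compare
  this with the empirical loss, up to an event of probability \<open>\<delta>/8\<close>; the second summand of \<open>B\<close> alone
  suffices here.  The second term is at most \<open>C\<close> by Chebyshev's inequality, up to an event of
  probability \<open>\<delta>/2\<close>.
\<close>

section \<open>Total variation distance and Pinsker's inequality\<close>

lemma tv_dist_commute: "tv_dist p q = tv_dist q p"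
  by (simp add: tv_dist_def abs_minus_commute)

lemma tv_dist_triangle: "tv_dist p r \<le> tv_dist p q + tv_dist q r"
  unfolding tv_dist_def distrib_left[symmetric] sum.distrib[symmetric]
  by (intro mult_left_mono sum_mono) auto

lemma tv_dist_nonneg: "0 \<le> tv_dist p q"
  by (simp add: tv_dist_def sum_nonneg)

lemma sum_pmf_UNIV: "(\<Sum>x\<in>UNIV. pmf p x) = 1" for p :: "'b::finite pmf"
  by (rule sum_pmf_eq_1) auto

text \<open>Both mass functions have total mass 1, so the positive and the negative part of their
  difference have equal sums, each being half of the absolute sum.\<close>

lemma tv_dist_eq_sum:
  "tv_dist p q = (\<Sum>x | pmf q x < pmf p x. pmf p x - pmf q x)"
proof -
  let ?A = "{x. pmf q x < pmf p x}"
  have split: "(\<Sum>x\<in>UNIV. f x) = (\<Sum>x\<in>?A. f x) + (\<Sum>x\<in>-?A. f x)" for f :: "'a \<Rightarrow> real"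
    by (metis (no_types) add.commute finite_code sum.subset_diff Compl_eq_Diff_UNIV subset_UNIV)
  have "(\<Sum>x\<in>UNIV. pmf p x - pmf q x) = 0"
    by (simp add: sum_subtractf sum_pmf_UNIV)
  hence neg: "(\<Sum>x\<in>-?A. pmf p x - pmf q x) = - (\<Sum>x\<in>?A. pmf p x - pmf q x)"
    using split[of "\<lambda>x. pmf p x - pmf q x"] by linarith
  have "(\<Sum>x\<in>-?A. \<bar>pmf p x - pmf q x\<bar>) = (\<Sum>x\<in>-?A. - (pmf p x - pmf q x))"
    by (intro sum.cong) auto
  also have "\<dots> = - (\<Sum>x\<in>-?A. pmf p x - pmf q x)"
    by (rule sum_negf)
  finally have 1: "(\<Sum>x\<in>-?A. \<bar>pmf p x - pmf q x\<bar>) = (\<Sum>x\<in>?A. pmf p x - pmf q x)"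
    using neg by simp
  have 2: "(\<Sum>x\<in>?A. \<bar>pmf p x - pmf q x\<bar>) = (\<Sum>x\<in>?A. pmf p x - pmf q x)"
    by (intro sum.cong) auto
  show ?thesis
    unfolding tv_dist_def split[of "\<lambda>x. \<bar>pmf p x - pmf q x\<bar>"] 1 2 by simp
qed

text \<open>
  Gibbs' variational inequality for the indicator of \<open>{q < r}\<close>, with the exponential moment bounded by
  Hoeffding's lemma; the choice \<open>h = 4 TV\<close> is optimal.
\<close>

lemma pinsker: "ereal (2 * (tv_dist r q)\<^sup>2) \<le> kl_div UNIV (pmf r) (pmf q)"
proof (cases "\<forall>x. pmf q x = 0 \<longrightarrow> pmf r x = 0")
  case False
  then show ?thesis by (auto simp: kl_div_def)
next
  case True
  define A where "A = {x. pmf q x < pmf r x}"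
  define t where "t = tv_dist r q"
  define h where "h = 4 * t"
  define a where "a = (\<Sum>x\<in>A. pmf q x)"
  define Z where "Z = 1 + a * (exp h - 1)"
  define g where "g x = h * indicator A x" for x
  have h: "0 \<le> h" by (simp add: h_def t_def tv_dist_nonneg)
  have a: "0 \<le> a" by (simp add: a_def sum_nonneg)
  have Z: "0 < Z" using h a by (auto simp: Z_def intro!: add_pos_nonneg)
  have tA: "t = (\<Sum>x\<in>A. pmf r x) - a"
    by (simp add: t_def tv_dist_eq_sum A_def a_def sum_subtractf)
  \<comment> \<open>This is \<open>ln u \<le> u - 1\<close> for the ratio \<open>u\<close> of the
    tilted mass \<open>pmf q x * exp (g x) / Z\<close> to \<open>pmf r x\<close>. The last two terms
    on the left cancel after summation, since \<open>Z\<close> normalizes the tilted mass to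
    1.\<close>
  have point: "pmf r x * (g x - ln Z) + pmf r x - pmf q x * exp (g x) / Z
      \<le> pmf r x * ln (pmf r x / pmf q x)" for x
  proof (cases "pmf r x = 0")
    case True
    then show ?thesis using Z by simp
  next
    case False
    hence r: "0 < pmf r x" and q: "0 < pmf q x"
      using True by (auto simp: pmf_positive_iff set_pmf_iff)
    define u where "u = pmf q x * exp (g x) / (pmf r x * Z)"
    have u: "0 < u" using r q Z by (simp add: u_def)
    have "ln u = g x - ln Z - ln (pmf r x / pmf q x)"
      using r q Z by (simp add: u_def ln_mult ln_div)
    moreover have "ln u \<le> u - 1" using u by (rule ln_le_minus_one)
    ultimately have "pmf r x * (g x - ln Z + 1 - u) \<le> pmf r x * ln (pmf r x / pmf q x)"
      using r by (intro mult_left_mono) auto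
    moreover have "pmf r x * u = pmf q x * exp (g x) / Z"
      using r by (simp add: u_def)
    ultimately show ?thesis by (simp add: algebra_simps)
  qed
  have sumg: "(\<Sum>x\<in>UNIV. pmf r x * g x) = h * (\<Sum>x\<in>A. pmf r x)"
  proof -
    have "(\<Sum>x\<in>UNIV. pmf r x * g x) = (\<Sum>x\<in>UNIV. if x \<in> A then h * pmf r x else 0)"
      by (intro sum.cong) (auto simp: g_def)
    then show ?thesis by (simp add: sum.If_cases sum_distrib_left)
  qed
  have "(\<Sum>x\<in>UNIV. pmf q x * exp (g x)) = (\<Sum>x\<in>UNIV. pmf q x + (exp h - 1) * (if x \<in> A then pmf q x else 0))"
    by (intro sum.cong) (auto simp: g_def algebra_simps)
  also have "\<dots> = Z"
    by (simp add: sum.distrib sum_pmf_UNIV sum_distrib_left[symmetric] sum.If_cases a_def Z_def)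
  finally have sumq: "(\<Sum>x\<in>UNIV. pmf q x * exp (g x)) = Z" .
  have "(\<Sum>x\<in>UNIV. pmf r x * (g x - ln Z) + pmf r x - pmf q x * exp (g x) / Z)
      = h * (\<Sum>x\<in>A. pmf r x) - ln Z"
    using Z by (simp add: sum.distrib sum_subtractf right_diff_distrib sumg sumq
        sum_distrib_right[symmetric] sum_divide_distrib[symmetric] sum_pmf_UNIV)
  moreover have "ln Z \<le> h * a + h\<^sup>2 / 8"
    using Hoeffdings_lemma_aux[OF h a] by (simp add: Z_def)
  moreover have "h * (\<Sum>x\<in>A. pmf r x) - (h * a + h\<^sup>2 / 8) = 2 * t\<^sup>2"
    by (simp add: tA h_def power2_eq_square field_simps)
  ultimately have "2 * t\<^sup>2 \<le> (\<Sum>x\<in>UNIV. pmf r x * ln (pmf r x / pmf q x))"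
    using sum_mono[of UNIV, OF point, of "\<lambda>x. x"] by linarith
  then show ?thesis using True by (simp add: kl_div_def t_def)
qed

section \<open>Conditional probabilities under masks and the tensorization step\<close>

lemma completions_self: "x \<in> completions K x"
  by (simp add: completions_def)

lemma completions_commute: "x' \<in> completions K x \<longleftrightarrow> x \<in> completions K x'"
  by (auto simp: completions_def)

lemma cond_prob_nonneg: "0 \<le> cond_prob pK q K x"
  by (simp add: cond_prob_def sum_nonneg)

lemma cond_prob_le_1: "cond_prob pK q K x \<le> 1"
proof -
  let ?Z = "\<Sum>x'\<in>completions K x. pmf q x' * pmf (pK x') K"
  have "pmf q x * pmf (pK x) K \<le> ?Z"
    by (rule member_le_sum) (auto simp: completions_self)
  moreover have "0 \<le> ?Z" by (simp add: sum_nonneg)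
  ultimately show ?thesis
    by (cases "?Z = 0") (auto simp: cond_prob_def)
qed

text \<open>The numerator is one of the nonnegative summands of the denominator, so a positive
  numerator forces a positive denominator. This turns the support margin into a lower bound for
  every sequence and mask that the data can contain.\<close>

lemma cond_prob_pos_iff:
  "0 < cond_prob pK q K x \<longleftrightarrow> x \<in> set_pmf q \<and> K \<in> set_pmf (pK x)"
proof -
  have "pmf q x * pmf (pK x) K \<le> (\<Sum>x'\<in>completions K x. pmf q x' * pmf (pK x') K)"
    by (rule member_le_sum) (auto simp: completions_self)
  moreover have "0 \<le> pmf q x * pmf (pK x) K" by simp
  ultimately have "0 < cond_prob pK q K x \<longleftrightarrow> 0 < pmf q x * pmf (pK x) K"
    unfolding cond_prob_def zero_less_divide_iff by linarith
  then show ?thesis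
    by (simp add: zero_less_mult_iff pmf_positive_iff)
qed

text \<open>The mean log loss over the random masks of a fixed sequence; it links the conditional
  cross entropy from tensorization to the empirical loss.\<close>

definition mask_loss ::
  "(('n::finite \<Rightarrow> 'a::finite) \<Rightarrow> 'n set pmf) \<Rightarrow> ('n \<Rightarrow> 'a) pmf \<Rightarrow> ('n \<Rightarrow> 'a) \<Rightarrow> real" where
  "mask_loss pK q x = (\<Sum>K\<in>UNIV. pmf (pK x) K * - ln (cond_prob pK q K x))"

text \<open>For a fixed mask \<open>K\<close> the completion sets partition the sequences, and
  averaging \<open>f\<close> over each class with its conditional weights preserves the total: the
  tower property of conditional expectation.\<close>

lemma sum_pmf_cond_prob_swap:
  "(\<Sum>x\<in>UNIV. pmf r x * pmf (pK x) K * (\<Sum>x'\<in>completions K x. cond_prob pK r K x' * f x'))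
     = (\<Sum>x\<in>UNIV. pmf r x * pmf (pK x) K * f x)"
proof -
  define w where "w x = pmf r x * pmf (pK x) K" for x
  have cp: "cond_prob pK r K x = w x / sum w (completions K x)" for x
    by (simp add: cond_prob_def w_def[abs_def])
  \<comment> \<open>Writing membership as a case distinction lets both sums range over all
    sequences, so that they can be exchanged; by symmetry the inner sum then runs over the class of
    \<open>x'\<close>.\<close>
  have "(\<Sum>x\<in>UNIV. w x * (\<Sum>x'\<in>completions K x. cond_prob pK r K x' * f x'))
      = (\<Sum>x\<in>UNIV. \<Sum>x'\<in>UNIV. if x' \<in> completions K x then w x * cond_prob pK r K x' * f x' else 0)"
    by (simp add: sum_distrib_left mult.assoc sum.If_cases)
  also have "\<dots> = (\<Sum>x'\<in>UNIV. \<Sum>x\<in>UNIV. if x \<in> completions K x' then w x * cond_prob pK r K x' * f x' else 0)"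
    by (subst sum.swap) (simp add: completions_commute)
  also have "\<dots> = (\<Sum>x'\<in>UNIV. sum w (completions K x') * cond_prob pK r K x' * f x')"
    by (simp add: sum_distrib_right mult.assoc sum.If_cases)
  also have "\<dots> = (\<Sum>x\<in>UNIV. w x * f x)"
  proof (rule sum.cong[OF refl])
    fix x
    \<comment> \<open>In a class of total weight zero the quotient is 0 in HOL, but then
      \<open>w x\<close> is 0 as well, so the identity below still holds.\<close>
    have "w x \<le> sum w (completions K x)"
      by (rule member_le_sum) (auto simp: completions_self w_def)
    moreover have "0 \<le> w x" by (simp add: w_def)
    ultimately show "sum w (completions K x) * cond_prob pK r K x * f x = w x * f x"
      by (auto simp: cp)
  qed
  finally show ?thesis by (simp add: w_def)
qed

text \<open>
  The averaged conditional divergence is the cross entropy minus a nonnegative conditional entropy.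
\<close>

lemma conditional_kl_le_mask_loss:
  assumes pos: "\<And>x K. x \<in> set_pmf r \<Longrightarrow> K \<in> set_pmf (pK x) \<Longrightarrow> 0 < cond_prob pK q K x"
  shows "(\<Sum>x\<in>UNIV. ereal (pmf r x) * (\<Sum>K\<in>UNIV. ereal (pmf (pK x) K) *
            kl_div (completions K x) (cond_prob pK r K) (cond_prob pK q K)))
         \<le> ereal (\<Sum>x\<in>UNIV. pmf r x * mask_loss pK q x)"
proof -
  define H where "H K x = (\<Sum>x'\<in>completions K x. cond_prob pK r K x' * - ln (cond_prob pK q K x'))" for K x
  have kl: "kl_div (completions K x) (cond_prob pK r K) (cond_prob pK q K) \<le> ereal (H K x)" for K x
  proof -
    \<comment> \<open>A sequence with positive conditional probability under \<open>r\<close> lies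
      in the support of \<open>r\<close> and can receive the mask \<open>K\<close>, so
      \<open>pos\<close> applies. Hence the infinite branch of \<open>kl_div\<close> does not
      occur.\<close>
    have ac: "cond_prob pK q K x' = 0 \<longrightarrow> cond_prob pK r K x' = 0" for x'
      using pos[of x' K] cond_prob_pos_iff[of pK r K x'] cond_prob_nonneg[of pK r K x']
      by fastforce
    have "cond_prob pK r K x' * ln (cond_prob pK r K x' / cond_prob pK q K x')
        \<le> cond_prob pK r K x' * - ln (cond_prob pK q K x')" for x'
    proof (cases "cond_prob pK r K x' = 0")
      case False
      hence "0 < cond_prob pK r K x'" "0 < cond_prob pK q K x'"
        using ac[of x'] cond_prob_nonneg[of pK r K x'] cond_prob_nonneg[of pK q K x'] by auto
      then show ?thesis
        using cond_prob_le_1[of pK r K x'] by (intro mult_left_mono) (auto simp: ln_div)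
    qed simp
    then show ?thesis
      using ac by (auto simp: kl_div_def H_def intro!: sum_mono)
  qed
  have "(\<Sum>x\<in>UNIV. ereal (pmf r x) * (\<Sum>K\<in>UNIV. ereal (pmf (pK x) K) *
            kl_div (completions K x) (cond_prob pK r K) (cond_prob pK q K)))
      \<le> (\<Sum>x\<in>UNIV. ereal (pmf r x) * (\<Sum>K\<in>UNIV. ereal (pmf (pK x) K) * ereal (H K x)))"
    by (intro sum_mono ereal_mult_left_mono kl) auto
  also have "\<dots> = ereal (\<Sum>x\<in>UNIV. \<Sum>K\<in>UNIV. pmf r x * pmf (pK x) K * H K x)"
    by (simp add: sum_distrib_left mult.assoc)
  also have "(\<Sum>x\<in>UNIV. \<Sum>K\<in>UNIV. pmf r x * pmf (pK x) K * H K x)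
      = (\<Sum>K\<in>UNIV. \<Sum>x\<in>UNIV. pmf r x * pmf (pK x) K * H K x)"
    by (rule sum.swap)
  also have "\<dots> = (\<Sum>K\<in>UNIV. \<Sum>x\<in>UNIV. pmf r x * pmf (pK x) K * - ln (cond_prob pK q K x))"
    unfolding H_def by (subst sum_pmf_cond_prob_swap) (rule refl)
  also have "\<dots> = (\<Sum>x\<in>UNIV. pmf r x * mask_loss pK q x)"
    by (subst sum.swap) (simp add: mask_loss_def sum_distrib_left mult.assoc)
  finally show ?thesis .
qed

text \<open>Pinsker's inequality, tensorization with \<open>r\<close> as test distribution and the
  cross entropy bound are chained. It is meant for \<open>r\<close> the empirical distribution of
  the sequences.\<close>

lemma tv_dist_le_sqrt_mask_loss:
  assumes "block_approx_tensorization pK q c"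
    and pos: "\<And>x K. x \<in> set_pmf r \<Longrightarrow> K \<in> set_pmf (pK x) \<Longrightarrow> 0 < cond_prob pK q K x"
  shows "tv_dist q r \<le> sqrt (1 / 2 * c * (\<Sum>x\<in>UNIV. pmf r x * mask_loss pK q x))"
proof -
  have "ereal (2 * (tv_dist r q)\<^sup>2) \<le> kl_div UNIV (pmf r) (pmf q)"
    by (rule pinsker)
  also have "\<dots> \<le> ereal c * (\<Sum>x\<in>UNIV. ereal (pmf r x) * (\<Sum>K\<in>UNIV. ereal (pmf (pK x) K) *
          kl_div (completions K x) (cond_prob pK r K) (cond_prob pK q K)))"
    using assms(1) by (simp add: block_approx_tensorization_def)
  also have "\<dots> \<le> ereal c * ereal (\<Sum>x\<in>UNIV. pmf r x * mask_loss pK q x)"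
    using assms(1)
    by (intro ereal_mult_left_mono conditional_kl_le_mask_loss pos)
      (auto simp: block_approx_tensorization_def)
  finally have "(tv_dist r q)\<^sup>2 \<le> 1 / 2 * c * (\<Sum>x\<in>UNIV. pmf r x * mask_loss pK q x)"
    by simp
  then show ?thesis
    by (subst tv_dist_commute) (rule real_le_rsqrt)
qed


section \<open>Moments and concentration for product distributions\<close>

lemma set_pmf_Pi_pmf_component:
  assumes "finite I" "i \<in> I" "D \<in> set_pmf (Pi_pmf I d Q)"
  shows "D i \<in> set_pmf (Q i)"
  using set_Pi_pmf_subset'[of I d Q] assms by (auto simp: PiE_dflt_def)

lemma expectation_component_Pi_pmf:
  fixes h :: "'b \<Rightarrow> real"
  assumes "finite I" "i \<in> I"
  shows "measure_pmf.expectation (Pi_pmf I d Q) (\<lambda>D. h (D i)) = measure_pmf.expectation (Q i) h"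
proof -
  have "measure_pmf.expectation (Q i) h
      = measure_pmf.expectation (map_pmf (\<lambda>D. D i) (Pi_pmf I d Q)) h"
    using assms by (simp add: Pi_pmf_component)
  then show ?thesis by simp
qed

lemma indep_vars_Pi_pmf_compose:
  assumes "finite I"
  shows "prob_space.indep_vars (measure_pmf (Pi_pmf I d Q)) (\<lambda>_. borel) (\<lambda>i D. h (D i) :: real) I"
  by (intro prob_space.indep_vars_compose2[OF _ indep_vars_Pi_pmf] assms prob_space_measure_pmf) auto

text \<open>Independence and centering make the cross term vanish at each step of an induction on
  the index set. Boundedness supplies integrability.\<close>

lemma expectation_square_sum_Pi_pmf:
  fixes h :: "'b \<Rightarrow> real"
  assumes fin: "finite I"
    and bound: "\<And>y. \<bar>h y\<bar> \<le> c"
    and centered: "measure_pmf.expectation Q h = 0"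
  shows "measure_pmf.expectation (Pi_pmf I d (\<lambda>_. Q)) (\<lambda>D. (\<Sum>i\<in>I. h (D i))\<^sup>2)
    = real (card I) * measure_pmf.expectation Q (\<lambda>y. (h y)\<^sup>2)"
proof -
  let ?P = "Pi_pmf I d (\<lambda>_. Q)"
  have sum_bound: "\<bar>\<Sum>i\<in>J. h (D i)\<bar> \<le> real (card J) * c" for J and D :: "'a \<Rightarrow> 'b"
  proof -
    have "\<bar>\<Sum>i\<in>J. h (D i)\<bar> \<le> (\<Sum>i\<in>J. \<bar>h (D i)\<bar>)" by (rule sum_abs)
    also have "\<dots> \<le> (\<Sum>i\<in>J. c)" by (intro sum_mono bound)
    finally show ?thesis by simp
  qed
  have int_sum: "integrable (measure_pmf ?P) (\<lambda>D. \<Sum>i\<in>J. h (D i))" for J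
    by (rule measure_pmf.integrable_const_bound[where B="real (card J) * c"]) (auto simp: sum_bound)
  have int_h: "integrable (measure_pmf ?P) (\<lambda>D. h (D i))" for i
    using int_sum[of "{i}"] by simp
  have int_sq: "integrable (measure_pmf ?P) (\<lambda>D. (\<Sum>i\<in>J. h (D i))\<^sup>2)" for J
  proof (rule measure_pmf.integrable_const_bound[where B="(real (card J) * c)\<^sup>2"])
    have "\<bar>\<Sum>i\<in>J. h (D i)\<bar>\<^sup>2 \<le> (real (card J) * c)\<^sup>2" for D
      by (rule power_mono[OF sum_bound abs_ge_zero])
    then show "AE D in measure_pmf ?P. norm ((\<Sum>i\<in>J. h (D i))\<^sup>2) \<le> (real (card J) * c)\<^sup>2"
      by simp
  qed simp
  have "J \<subseteq> I \<Longrightarrow> measure_pmf.expectation ?P (\<lambda>D. (\<Sum>i\<in>J. h (D i))\<^sup>2)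
      = real (card J) * measure_pmf.expectation Q (\<lambda>y. (h y)\<^sup>2)" if "finite J" for J
    using that
  proof (induction J)
    case empty
    then show ?case by simp
  next
    case (insert i J)
    let ?S = "\<lambda>D. \<Sum>i\<in>J. h (D i)"
    have i: "i \<in> I" using insert.prems by simp
    have "prob_space.indep_vars (measure_pmf ?P) (\<lambda>_. borel) (\<lambda>i D. h (D i)) (insert i J)"
      by (rule prob_space.indep_vars_subset[OF prob_space_measure_pmf indep_vars_Pi_pmf_compose[OF fin] insert.prems])
    then have indep: "prob_space.indep_var (measure_pmf ?P) borel (\<lambda>D. h (D i)) borel ?S"
      by (rule prob_space.indep_vars_sum[OF prob_space_measure_pmf insert.hyps])
    have cross: "measure_pmf.expectation ?P (\<lambda>D. h (D i) * ?S D) = 0"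
      using prob_space.indep_var_lebesgue_integral[OF prob_space_measure_pmf indep int_h int_sum]
      by (simp add: expectation_component_Pi_pmf[OF fin i] centered)
    have int_cross: "integrable (measure_pmf ?P) (\<lambda>D. h (D i) * ?S D)"
      by (rule prob_space.indep_var_integrable[OF prob_space_measure_pmf indep int_h int_sum])
    have "measure_pmf.expectation ?P (\<lambda>D. (\<Sum>i\<in>insert i J. h (D i))\<^sup>2)
        = measure_pmf.expectation ?P (\<lambda>D. (h (D i))\<^sup>2 + 2 * (h (D i) * ?S D) + (?S D)\<^sup>2)"
      using insert.hyps by (simp add: power2_sum algebra_simps)
    also have "\<dots> = measure_pmf.expectation ?P (\<lambda>D. (h (D i))\<^sup>2)
        + measure_pmf.expectation ?P (\<lambda>D. (?S D)\<^sup>2)"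
      using int_sq[of "{i}"] int_sq[of J] int_cross cross by simp
    also have "measure_pmf.expectation ?P (\<lambda>D. (h (D i))\<^sup>2)
        = measure_pmf.expectation Q (\<lambda>y. (h y)\<^sup>2)"
      by (rule expectation_component_Pi_pmf[OF fin i])
    finally show ?case
      using insert by (simp add: algebra_simps)
  qed
  then show ?thesis using fin by blast
qed

text \<open>Chebyshev's method: Cauchy-Schwarz bounds the squared l1 distance by the multiple
  \<open>U\<close> of a sum of squared centered counts, whose means come from Bernoulli variances;
  Markov's inequality is then applied to \<open>U\<close>.\<close>

lemma empirical_tv_dist_tail:
  fixes g :: "'b \<Rightarrow> 'c::finite"
  assumes n: "0 < n" and t: "0 < t"
  shows "measure_pmf.prob (Pi_pmf {..<n} d (\<lambda>_. Q))
           {D. t \<le> tv_dist (map_pmf (\<lambda>i. g (D i)) (pmf_of_set {..<n})) (map_pmf g Q)}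
         \<le> (real CARD('c) - 1) / (4 * real n * t\<^sup>2)"
proof -
  let ?P = "Pi_pmf {..<n} d (\<lambda>_. Q)"
  let ?q = "map_pmf g Q"
  define tv where "tv D = tv_dist (map_pmf (\<lambda>i. g (D i)) (pmf_of_set {..<n})) ?q" for D :: "nat \<Rightarrow> 'b"
  define h where "h x y = indicator (g -` {x}) y - pmf ?q x" for x y
  define U where "U D = (real CARD('c) / (real n)\<^sup>2) * (\<Sum>x\<in>UNIV. (\<Sum>i<n. h x (D i))\<^sup>2)" for D
  have h_bound: "\<bar>h x y\<bar> \<le> 1" for x y
    using pmf_le_1[of ?q x] by (auto simp: h_def indicator_def)
  have int_ind: "integrable (measure_pmf Q) (indicator A :: 'b \<Rightarrow> real)" for A
    by (rule measure_pmf.integrable_const_bound[where B=1]) auto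
  have h_mean: "measure_pmf.expectation Q (h x) = 0" for x
    unfolding h_def using int_ind by (simp add: pmf_map)
  have h_var: "measure_pmf.expectation Q (\<lambda>y. (h x y)\<^sup>2) = pmf ?q x - (pmf ?q x)\<^sup>2" for x
  proof -
    have sq: "(\<lambda>y. (h x y)\<^sup>2)
        = (\<lambda>y. (1 - 2 * pmf ?q x) * indicator (g -` {x}) y + (pmf ?q x)\<^sup>2)"
      by (auto simp: h_def indicator_def power2_eq_square algebra_simps)
    show ?thesis
      unfolding sq using int_ind by (simp add: pmf_map power2_eq_square algebra_simps)
  qed
  have U_int: "integrable (measure_pmf ?P) (\<lambda>D. (\<Sum>i<n. h x (D i))\<^sup>2)" for x
  proof (rule measure_pmf.integrable_const_bound[where B="(real n)\<^sup>2"])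
    have "\<bar>\<Sum>i<n. h x (D i)\<bar> \<le> real n" for D
      using sum_norm_bound[of "{..<n}" "\<lambda>i. h x (D i)" 1] h_bound by simp
    then show "AE D in measure_pmf ?P. norm ((\<Sum>i<n. h x (D i))\<^sup>2) \<le> (real n)\<^sup>2"
      by (auto simp: abs_le_square_iff[symmetric])
  qed simp
  have dev: "pmf (map_pmf (\<lambda>i. g (D i)) (pmf_of_set {..<n})) x - pmf ?q x = (\<Sum>i<n. h x (D i)) / real n" for x D
  proof -
    have "pmf (map_pmf (\<lambda>i. g (D i)) (pmf_of_set {..<n})) x = (\<Sum>i<n. indicator (g -` {x}) (D i)) / real n"
      using n by (simp add: pmf_map measure_pmf_of_set lessThan_empty_iff indicator_def sum.If_cases vimage_def Int_def)
    then show ?thesis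
      using n by (simp add: h_def sum_subtractf diff_divide_distrib)
  qed
  have tv_le: "4 * (tv D)\<^sup>2 \<le> U D" for D
  proof -
    have "tv D = 1 / 2 * (\<Sum>x\<in>UNIV. \<bar>(\<Sum>i<n. h x (D i)) / real n\<bar>)"
      by (simp add: tv_def tv_dist_def dev)
    then have "4 * (tv D)\<^sup>2 = (\<Sum>x\<in>UNIV. \<bar>(\<Sum>i<n. h x (D i)) / real n\<bar>)\<^sup>2"
      by (simp only: power_mult_distrib) (simp add: power_divide)
    also have "\<dots> \<le> (\<Sum>x\<in>UNIV. \<bar>(\<Sum>i<n. h x (D i)) / real n\<bar>\<^sup>2) * real CARD('c)"
      by (rule sum_squared_le_sum_of_squares)
    also have "\<dots> = U D"
      by (simp add: U_def power_divide sum_divide_distrib[symmetric])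
    finally show ?thesis .
  qed
  \<comment> \<open>Cauchy-Schwarz again: the squared masses sum to at least
    \<open>1 / CARD('c)\<close>, so the variances sum to at most \<open>1 - 1 / CARD('c)\<close>.
    This produces the numerator \<open>CARD('c) - 1\<close>.\<close>
  have "1 \<le> real CARD('c) * (\<Sum>x\<in>UNIV. (pmf ?q x)\<^sup>2)"
    using sum_squared_le_sum_of_squares[of "pmf ?q" UNIV] sum_pmf_eq_1[of UNIV ?q]
    by (simp add: mult.commute)
  then have "real CARD('c) * (\<Sum>x\<in>UNIV. pmf ?q x - (pmf ?q x)\<^sup>2) \<le> real CARD('c) - 1"
    using sum_pmf_eq_1[of UNIV ?q] by (simp add: sum_subtractf algebra_simps)
  moreover have "measure_pmf.expectation ?P U
      = real CARD('c) / (real n)\<^sup>2 * (\<Sum>x\<in>UNIV. real n * (pmf ?q x - (pmf ?q x)\<^sup>2))"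
    unfolding U_def using U_int
    by (simp add: expectation_square_sum_Pi_pmf[OF _ h_bound h_mean] h_var)
  ultimately have EU: "measure_pmf.expectation ?P U \<le> (real CARD('c) - 1) / real n"
    using n by (simp add: sum_distrib_left[symmetric] power2_eq_square divide_right_mono)
  have "measure_pmf.prob ?P {D. t \<le> tv D} \<le> measure_pmf.prob ?P {D. 4 * t\<^sup>2 \<le> U D}"
  proof (rule measure_pmf.finite_measure_mono)
    show "{D. t \<le> tv D} \<subseteq> {D. 4 * t\<^sup>2 \<le> U D}"
      using tv_le t by (auto intro!: order_trans[OF _ tv_le])
  qed simp
  also have "\<dots> \<le> measure_pmf.expectation ?P U / (4 * t\<^sup>2)"
  proof -
    have "integrable (measure_pmf ?P) U"
      unfolding U_def using U_int by auto
    moreover have "0 \<le> U D" for D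
      by (simp add: U_def sum_nonneg)
    ultimately show ?thesis
      using integral_Markov_inequality_measure[of ?P U "{}" "4 * t\<^sup>2"] t by simp
  qed
  also have "\<dots> \<le> (real CARD('c) - 1) / real n / (4 * t\<^sup>2)"
    using EU by (intro divide_right_mono) auto
  finally show ?thesis by (simp add: tv_def mult_ac)
qed

text \<open>
  Conditionally on the first components \<open>x\<^sub>i\<close> the summands are independent and the sum has mean
  \<open>\<Sum>\<^sub>i G (x\<^sub>i)\<close>, so only the range of \<open>F\<close>, and not that of \<open>F - G\<close>, enters the exponent.
\<close>

lemma conditional_Hoeffding_Pi_pmf:
  fixes F :: "'x \<times> 'y \<Rightarrow> real" and \<kappa> :: "'x \<Rightarrow> 'y pmf"
  assumes fin: "finite I" "I \<noteq> {}" and ab: "a < b" and s: "0 \<le> s"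
    and range: "\<And>x y. x \<in> set_pmf P \<Longrightarrow> y \<in> set_pmf (\<kappa> x) \<Longrightarrow> F (x, y) \<in> {a..b}"
    and G: "\<And>x. x \<in> set_pmf P \<Longrightarrow> G x = measure_pmf.expectation (\<kappa> x) (\<lambda>y. F (x, y))"
  shows "measure_pmf.prob (Pi_pmf I d (\<lambda>_. bind_pmf P (\<lambda>x. map_pmf (Pair x) (\<kappa> x))))
           {D. (\<Sum>i\<in>I. F (D i)) \<le> (\<Sum>i\<in>I. G (fst (D i))) - s}
         \<le> exp (- 2 * s\<^sup>2 / (real (card I) * (b - a)\<^sup>2))"
proof -
  let ?E = "{D. (\<Sum>i\<in>I. F (D i)) \<le> (\<Sum>i\<in>I. G (fst (D i))) - s}"
  let ?e = "exp (- 2 * s\<^sup>2 / (real (card I) * (b - a)\<^sup>2))"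
  \<comment> \<open>\<open>R xs\<close> is the law of the family once its first components are fixed
    to \<open>xs\<close>.\<close>
  define R where "R xs = Pi_pmf I d (\<lambda>i. map_pmf (Pair (xs i)) (\<kappa> (xs i)))" for xs
  have cond: "measure_pmf.prob (R xs) ?E \<le> ?e"
    if xs: "xs \<in> set_pmf (Pi_pmf I undefined (\<lambda>_. P))" for xs
  proof -
    have x: "xs i \<in> set_pmf P" if "i \<in> I" for i
      using set_pmf_Pi_pmf_component[OF fin(1) that xs] .
    have D: "\<exists>y\<in>set_pmf (\<kappa> (xs i)). D i = (xs i, y)" if "D \<in> set_pmf (R xs)" "i \<in> I" for D i
      using set_pmf_Pi_pmf_component[OF fin(1) that(2) that(1)[unfolded R_def]] by auto
    interpret H: Hoeffding_ineq "measure_pmf (R xs)" I "\<lambda>i D. F (D i)" "\<lambda>_. a" "\<lambda>_. b"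
      "\<Sum>i\<in>I. measure_pmf.expectation (R xs) (\<lambda>D. F (D i))"
    proof unfold_locales
      show "prob_space.indep_vars (measure_pmf (R xs)) (\<lambda>_. borel) (\<lambda>i D. F (D i)) I"
        unfolding R_def by (rule indep_vars_Pi_pmf_compose[OF fin(1)])
      show "AE D in measure_pmf (R xs). F (D i) \<in> {a..b}" if "i \<in> I" for i
        using D[OF _ that] range[OF x[OF that]] by (fastforce simp: AE_measure_pmf_iff)
    qed (fact fin(1))
    have mean: "measure_pmf.expectation (R xs) (\<lambda>D. F (D i)) = G (xs i)" if "i \<in> I" for i
      unfolding R_def using that x[OF that] by (simp add: expectation_component_Pi_pmf[OF fin(1)] G)
    have "measure_pmf.prob (R xs) ?E \<le> measure_pmf.prob (R xs)
        {D \<in> space (measure_pmf (R xs)). (\<Sum>i\<in>I. F (D i))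
          \<le> (\<Sum>i\<in>I. measure_pmf.expectation (R xs) (\<lambda>D. F (D i))) - s}"
    proof (rule measure_pmf.finite_measure_mono_AE)
      \<comment> \<open>On the support of \<open>R xs\<close> the first components are those of
        \<open>xs\<close>, so the random threshold becomes the constant that Hoeffding's inequality
        requires.\<close>
      have "(\<Sum>i\<in>I. G (fst (D i))) = (\<Sum>i\<in>I. G (xs i))" if "D \<in> set_pmf (R xs)" for D
        using D[OF that] by (intro sum.cong) fastforce+
      then show "AE D in measure_pmf (R xs). D \<in> ?E \<longrightarrow> D \<in> {D \<in> space (measure_pmf (R xs)). (\<Sum>i\<in>I. F (D i))
          \<le> (\<Sum>i\<in>I. measure_pmf.expectation (R xs) (\<lambda>D. F (D i))) - s}"
        by (auto simp: AE_measure_pmf_iff mean)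
    qed simp
    also have "\<dots> \<le> exp (- 2 * s\<^sup>2 / (\<Sum>i\<in>I. (b - a)\<^sup>2))"
      using fin ab s by (intro H.Hoeffding_ineq_le) (auto simp: card_gt_0_iff zero_less_mult_iff)
    finally show ?thesis by simp
  qed
  \<comment> \<open>A product of mixtures is a mixture of products: all first components are drawn
    before the second ones.\<close>
  have "emeasure (measure_pmf (Pi_pmf I d (\<lambda>_. bind_pmf P (\<lambda>x. map_pmf (Pair x) (\<kappa> x))))) ?E
      = (\<integral>\<^sup>+xs. emeasure (measure_pmf (R xs)) ?E \<partial>measure_pmf (Pi_pmf I undefined (\<lambda>_. P)))"
    unfolding R_def by (subst Pi_pmf_bind[OF fin(1), where d'=undefined]) simp
  also have "\<dots> \<le> (\<integral>\<^sup>+xs. ennreal ?e \<partial>measure_pmf (Pi_pmf I undefined (\<lambda>_. P)))"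
    using cond by (intro nn_integral_mono_AE)
      (auto simp: AE_measure_pmf_iff measure_pmf.emeasure_eq_measure intro!: ennreal_leI)
  also have "\<dots> = ennreal ?e"
    by (simp add: measure_pmf.emeasure_space_1[simplified])
  finally show ?thesis
    by (simp add: measure_pmf.emeasure_eq_measure)
qed


section \<open>Deviation of the empirical loss at a fixed parameter\<close>

lemma expectation_mask_average:
  assumes "0 < m"
  shows "measure_pmf.expectation (Pi_pmf {..<m} d (\<lambda>_. pK x))
      (\<lambda>ks. (\<Sum>j<m. - ln (cond_prob pK q (ks j) x)) / real m) = mask_loss pK q x"
proof -
  let ?P = "Pi_pmf {..<m} d (\<lambda>_. pK x)"
  let ?f = "\<lambda>K. - ln (cond_prob pK q K x)"
  \<comment> \<open>There are only finitely many masks, so the log loss is bounded by its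
    maximum.\<close>
  have int: "integrable (measure_pmf ?P) (\<lambda>ks. ?f (ks j))" for j
    by (auto intro!: Max_ge measure_pmf.integrable_const_bound[where B="Max (range (\<lambda>K. \<bar>?f K\<bar>))"])
  have "measure_pmf.expectation (pK x) ?f = mask_loss pK q x"
    unfolding mask_loss_def by (subst integral_measure_pmf_real[of UNIV]) (auto simp: mult.commute)
  then have "measure_pmf.expectation ?P (\<lambda>ks. \<Sum>j<m. ?f (ks j)) = real m * mask_loss pK q x"
    using int by (subst Bochner_Integration.integral_sum)
      (auto simp: expectation_component_Pi_pmf[where h="?f"] simp del: Bochner_Integration.integral_minus)
  then show ?thesis using assms by simp
qed

lemma set_pmf_data_pmf:
  assumes "D \<in> set_pmf (data_pmf pK pX n m)" "i < n"
  shows "fst (D i) \<in> set_pmf pX"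
    and "j < m \<Longrightarrow> snd (D i) j \<in> set_pmf (pK (fst (D i)))"
proof -
  have "D i \<in> set_pmf (bind_pmf pX (\<lambda>x. map_pmf (Pair x) (Pi_pmf {..<m} undefined (\<lambda>_. pK x))))"
    using assms by (intro set_pmf_Pi_pmf_component[where D=D]) (auto simp: data_pmf_def)
  then show "fst (D i) \<in> set_pmf pX"
    and "j < m \<Longrightarrow> snd (D i) j \<in> set_pmf (pK (fst (D i)))"
    by (auto intro: set_pmf_Pi_pmf_component[of "{..<m}"])
qed

text \<open>The masks of one sequence are averaged into a single variable, which the margin confines
  to an interval of length \<open>ln (1 / \<beta>)\<close>. There are \<open>n\<close> such
  variables, and since the deviation is measured in units of that length, the length cancels in
  Hoeffding's exponent.\<close>

lemma empirical_loss_tail: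
  assumes n: "0 < n" and m: "0 < m" and beta: "0 < \<beta>" "\<beta> < 1" and t: "0 \<le> t"
    and bound: "\<And>x K. x \<in> set_pmf pX \<Longrightarrow> K \<in> set_pmf (pK x) \<Longrightarrow> \<beta> \<le> cond_prob pK (p \<theta>) K x"
  shows "measure_pmf.prob (data_pmf pK pX n m)
      {D. empirical_loss pK p n m D \<theta>
        \<le> (\<Sum>i<n. mask_loss pK (p \<theta>) (fst (D i))) / real n - t * ln (1 / \<beta>)}
    \<le> exp (- 2 * real n * t\<^sup>2)"
proof -
  define M where "M = ln (1 / \<beta>)"
  have M: "0 < M" using beta by (simp add: M_def ln_div)
  define F where "F y = (\<Sum>j<m. - ln (cond_prob pK (p \<theta>) (snd y j) (fst y))) / real m" for y
  have F: "F (x, ks) \<in> {0..M}"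
    if "x \<in> set_pmf pX" "ks \<in> set_pmf (Pi_pmf {..<m} undefined (\<lambda>_. pK x))" for x ks
  proof -
    have "- ln (cond_prob pK (p \<theta>) (ks j) x) \<in> {0..M}" if "j < m" for j
    proof -
      have "\<beta> \<le> cond_prob pK (p \<theta>) (ks j) x"
        using bound \<open>x \<in> _\<close> set_pmf_Pi_pmf_component[OF _ _ \<open>ks \<in> _\<close>, of j] that by simp
      then show ?thesis
        using beta cond_prob_le_1[of pK "p \<theta>" "ks j" x] by (auto simp: M_def ln_div)
    qed
    then have "0 \<le> (\<Sum>j<m. - ln (cond_prob pK (p \<theta>) (ks j) x))"
        "(\<Sum>j<m. - ln (cond_prob pK (p \<theta>) (ks j) x)) \<le> (\<Sum>j<m. M)"
      by (intro sum_nonneg sum_mono; force)+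
    then show ?thesis
      using m by (simp add: F_def field_simps)
  qed
  have "{D. empirical_loss pK p n m D \<theta>
        \<le> (\<Sum>i<n. mask_loss pK (p \<theta>) (fst (D i))) / real n - t * M}
      = {D. (\<Sum>i<n. F (D i)) \<le> (\<Sum>i<n. mask_loss pK (p \<theta>) (fst (D i))) - real n * t * M}"
  proof -
    have "empirical_loss pK p n m D \<theta> = (\<Sum>i<n. F (D i)) / real n" for D
      by (simp add: empirical_loss_def F_def sum_divide_distrib[symmetric])
    then show ?thesis using n by (simp add: field_simps)
  qed
  moreover have "measure_pmf.prob (data_pmf pK pX n m)
      {D. (\<Sum>i<n. F (D i)) \<le> (\<Sum>i<n. mask_loss pK (p \<theta>) (fst (D i))) - real n * t * M}
      \<le> exp (- 2 * (real n * t * M)\<^sup>2 / (real (card {..<n}) * (M - 0)\<^sup>2))"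
    unfolding data_pmf_def
    using n t M F expectation_mask_average[OF m, of undefined pK _ "p \<theta>"]
    by (intro conditional_Hoeffding_Pi_pmf) (auto simp: F_def lessThan_empty_iff)
  moreover have "- 2 * (real n * t * M)\<^sup>2 / (real (card {..<n}) * (M - 0)\<^sup>2) = - 2 * real n * t\<^sup>2"
    using n M by (simp add: power2_eq_square)
  ultimately show ?thesis by (simp only: M_def)
qed

section \<open>Losses within a cell of the partition, and two computations for the final
  bound\<close>

lemma mask_loss_le_of_log_close:
  assumes "\<And>K. K \<in> set_pmf (pK x) \<Longrightarrow> log_close e (cond_prob pK q K x) (cond_prob pK q' K x)"
  shows "mask_loss pK q x \<le> mask_loss pK q' x + e"
proof -
  have "pmf (pK x) K * - ln (cond_prob pK q K x)
      \<le> pmf (pK x) K * - ln (cond_prob pK q' K x) + pmf (pK x) K * e" for K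
  proof (cases "K \<in> set_pmf (pK x)")
    case True
    then have "- ln (cond_prob pK q K x) \<le> - ln (cond_prob pK q' K x) + e"
      using assms[of K] by (auto simp: log_close_def)
    then show ?thesis
      unfolding distrib_left[symmetric] by (rule mult_left_mono) simp
  qed (simp add: set_pmf_iff)
  then have "mask_loss pK q x
      \<le> (\<Sum>K\<in>UNIV. pmf (pK x) K * - ln (cond_prob pK q' K x) + pmf (pK x) K * e)"
    unfolding mask_loss_def by (rule sum_mono)
  also have "\<dots> = mask_loss pK q' x + e"
    by (simp add: mask_loss_def sum_subtractf sum_negf sum_distrib_right[symmetric] sum_pmf_UNIV)
  finally show ?thesis .
qed

lemma empirical_loss_le_of_log_close:
  assumes n: "0 < n" and m: "0 < m"
    and close: "\<And>i j. i < n \<Longrightarrow> j < m \<Longrightarrow>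
      log_close e (cond_prob pK (p \<theta>) (snd (D i) j) (fst (D i)))
        (cond_prob pK (p \<theta>') (snd (D i) j) (fst (D i)))"
  shows "empirical_loss pK p n m D \<theta>' \<le> empirical_loss pK p n m D \<theta> + e"
proof -
  let ?f = "\<lambda>\<theta> i j. - ln (cond_prob pK (p \<theta>) (snd (D i) j) (fst (D i)))"
  have "?f \<theta>' i j \<le> ?f \<theta> i j + e" if "i < n" "j < m" for i j
    using close[OF that] by (auto simp: log_close_def)
  then have "(\<Sum>i<n. \<Sum>j<m. ?f \<theta>' i j) \<le> (\<Sum>i<n. \<Sum>j<m. ?f \<theta> i j + e)"
    by (intro sum_mono) auto
  also have "\<dots> = (\<Sum>i<n. \<Sum>j<m. ?f \<theta> i j) + real n * real m * e"
    by (simp add: sum_subtractf sum_negf)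
  finally show ?thesis
    using n m by (simp add: empirical_loss_def field_simps)
qed

lemma sum_empirical_pmf:
  fixes f :: "'b::finite \<Rightarrow> real"
  assumes "0 < n"
  shows "(\<Sum>x\<in>UNIV. pmf (map_pmf g (pmf_of_set {..<n})) x * f x) = (\<Sum>i<n. f (g i)) / real n"
proof -
  have "(\<Sum>x\<in>UNIV. pmf (map_pmf g (pmf_of_set {..<n})) x * f x)
      = measure_pmf.expectation (map_pmf g (pmf_of_set {..<n})) f"
    by (subst integral_measure_pmf_real[of UNIV]) (auto simp: mult.commute)
  also have "\<dots> = (\<Sum>i<n. f (g i)) / real n"
    using assms by (simp add: integral_pmf_of_set lessThan_empty_iff)
  finally show ?thesis .
qed

text \<open>With \<open>s\<close> the number of sequences, the left side is Chebyshev's bound at the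
  threshold \<open>C\<close> of the theorem and equals
  \<open>2 * \<delta> * (real s - 1) / real s ^ 3\<close>. The claim reduces to
  \<open>4 * (real s - 1) \<le> real s ^ 3\<close>, which follows from
  \<open>(real s - 2)\<^sup>2 \<ge> 0\<close> and \<open>s \<ge> 1\<close>.\<close>

lemma tv_deviation_bound:
  fixes s :: nat
  assumes s: "0 < s" and n: "0 < n" and \<delta>: "0 < \<delta>"
  shows "(real s - 1) / (4 * real n * (sqrt (real s ^ 3 / (8 * \<delta> * real n)))\<^sup>2) \<le> \<delta> / 2"
proof -
  have "4 * (real s - 1) \<le> real s * real s"
    using zero_le_power2[of "real s - 2"] by (simp add: power2_eq_square algebra_simps)
  also have "\<dots> \<le> real s * real s * real s"
    using s by (simp add: mult_le_cancel_left1)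
  finally have "4 * (real s - 1) \<le> real s ^ 3" by (simp add: power3_eq_cube)
  then have "\<delta> * (4 * (real s - 1)) \<le> \<delta> * real s ^ 3"
    using \<delta> by (intro mult_left_mono) auto
  then have "2 * \<delta> * (real s - 1) / real s ^ 3 \<le> \<delta> / 2"
    using s \<delta> by (simp add: field_simps)
  then show ?thesis
    using s n \<delta> by (simp add: field_simps)
qed


section \<open>Union bound over the partition and assembly of the estimate\<close>

theorem theorem4:
  fixes pX :: "('n::finite \<Rightarrow> 'a::finite) pmf"
    and pK :: "('n \<Rightarrow> 'a) \<Rightarrow> 'n set pmf"
    and \<K> :: "'n set set"
    and \<Theta> :: "'t set"
    and p :: "'t \<Rightarrow> ('n \<Rightarrow> 'a) pmf"
    and C_AT :: "('n \<Rightarrow> 'a) pmf \<Rightarrow> real"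
    and \<theta>hat :: "('n, 'a) dataset \<Rightarrow> 't"
    and n m :: nat
    and \<beta> \<epsilon> \<delta> :: real
  defines "B \<equiv> sqrt (2 ^ (3 * CARD('n)) * real CARD('a) ^ CARD('n) *
                     real (covering_number pK \<K> p \<Theta> \<epsilon>) / (real m * \<delta>))
             + sqrt (ln (8 * real (covering_number pK \<K> p \<Theta> \<epsilon>) / \<delta>) / (2 * real n))"
    and "C \<equiv> sqrt (real CARD('a) ^ (3 * CARD('n)) / (8 * \<delta> * real n))"
  assumes "n > 0" and "m > 0"
    and masks: "\<And>x. set_pmf (pK x) \<subseteq> \<K>"
    and beta: "0 < \<beta>" "\<beta> < 1"
    and margin: "support_margin pK pX p \<Theta> \<beta>"
    and covering: "\<And>e. e > 0 \<Longrightarrow> \<exists>P. covering_partition pK \<K> p \<Theta> e P"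
    and argmin: "\<And>D. D \<in> set_pmf (data_pmf pK pX n m) \<Longrightarrow>
                   is_arg_min (empirical_loss pK p n m D) (\<lambda>\<theta>. \<theta> \<in> \<Theta>) (\<theta>hat D)"
    and tensorization: "\<And>D. D \<in> set_pmf (data_pmf pK pX n m) \<Longrightarrow>
                   block_approx_tensorization pK (p (\<theta>hat D)) (C_AT (p (\<theta>hat D)))"
    and eps: "\<epsilon> > 0"
    and delta: "0 < \<delta>" "\<delta> < 1"
  shows "measure_pmf.prob (data_pmf pK pX n m)
           {D. tv_dist (p (\<theta>hat D)) pX
                 < sqrt (1/2 * C_AT (p (\<theta>hat D)) *
                         (empirical_loss pK p n m D (\<theta>hat D) + B * ln (1 / \<beta>) + \<epsilon>)) + C}
         \<ge> 1 - \<delta>"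
proof -
  let ?Q = "data_pmf pK pX n m"
  define M where "M = ln (1 / \<beta>)"
  define k where "k = covering_number pK \<K> p \<Theta> \<epsilon>"
  \<comment> \<open>The deviation at which a single representative fails with probability at most
    \<open>\<delta> / (8 * real k)\<close>; it is the second summand of \<open>B\<close>.\<close>
  define t where "t = sqrt (ln (8 * real k / \<delta>) / (2 * real n))"
  define emp where "emp D = map_pmf (\<lambda>i. fst (D i)) (pmf_of_set {..<n})" for D :: "('n, 'a) dataset"
  define L where "L D \<theta> = (\<Sum>i<n. mask_loss pK (p \<theta>) (fst (D i))) / real n"
    for D :: "('n, 'a) dataset" and \<theta>
  have n: "0 < n" and m: "0 < m" by fact+
  have M: "0 < M" using beta by (simp add: M_def ln_div)
  \<comment> \<open>Some finite partition exists, so the minimal cardinality \<open>k\<close> is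
    attained by a partition \<open>P\<close>.\<close>
  have "\<exists>k P. covering_partition pK \<K> p \<Theta> \<epsilon> P \<and> card P = k"
    using covering[OF eps] by blast
  from LeastI_ex[OF this] obtain P where cov: "covering_partition pK \<K> p \<Theta> \<epsilon> P" and "card P = k"
    unfolding k_def covering_number_def by blast
  have P: "finite P" "partition_on \<Theta> P"
    and close: "\<And>T \<theta>1 \<theta>2 x K. T \<in> P \<Longrightarrow> \<theta>1 \<in> T \<Longrightarrow> \<theta>2 \<in> T \<Longrightarrow> K \<in> \<K> \<Longrightarrow>
      log_close (\<epsilon> / 2) (cond_prob pK (p \<theta>1) K x) (cond_prob pK (p \<theta>2) K x)"
    using cov by (auto simp: covering_partition_def)
  have \<theta>hat: "\<theta>hat D \<in> \<Theta>" if "D \<in> set_pmf ?Q" for D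
    using argmin[OF that] by (simp add: is_arg_min_def)
  \<comment> \<open>The data distribution has nonempty support, so \<open>\<Theta>\<close> contains
    some \<open>\<theta>hat D\<close>. Hence \<open>k\<close> is positive and may stand in a
    denominator and a logarithm.\<close>
  have "P \<noteq> {}"
    using \<theta>hat set_pmf_not_empty[of ?Q] partition_onD1[OF P(2)] by fastforce
  then have k: "1 \<le> k"
    using P(1) \<open>card P = k\<close> by (metis One_nat_def Suc_leI card_gt_0_iff)
  \<comment> \<open>A representative depends on its cell alone and not on the data, so the tail
    bound for a fixed parameter applies to it, unlike to \<open>\<theta>hat D\<close>.\<close>
  define rep where "rep T = (SOME \<theta>. \<theta> \<in> T)" for T :: "'t set"
  have rep: "rep T \<in> T" if "T \<in> P" for T
  proof -
    have "T \<noteq> {}" using partition_onD3[OF P(2)] that by auto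
    then show ?thesis unfolding rep_def by (rule some_in_eq[THEN iffD2])
  qed
  have cond_pos: "\<beta> \<le> cond_prob pK (p \<theta>) K x"
    if "\<theta> \<in> \<Theta>" "x \<in> set_pmf pX" "K \<in> set_pmf (pK x)" for \<theta> x K
    using margin that by (simp add: support_margin_def cond_prob_pos_iff)

  \<comment> \<open>Since \<open>k \<ge> 1\<close> and \<open>\<delta> < 1\<close>, the logarithm is
    positive, so squaring undoes the square root in \<open>t\<close>.\<close>
  have "1 < 8 * real k / \<delta>" using k delta by (simp add: field_simps)
  then have ln_pos: "0 < ln (8 * real k / \<delta>)" by simp
  have t: "0 \<le> t" using ln_pos n by (simp add: t_def)
  have "- 2 * real n * t\<^sup>2 = - ln (8 * real k / \<delta>)"
    using ln_pos n by (simp add: t_def)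
  then have exp_t: "exp (- 2 * real n * t\<^sup>2) = \<delta> / (8 * real k)"
    using k delta by (simp add: exp_minus field_simps)
  have tB: "t \<le> B"
    unfolding B_def t_def k_def using delta by simp

  define bad where "bad T = {D. empirical_loss pK p n m D (rep T) \<le> L D (rep T) - t * M}" for T
  have "measure_pmf.prob ?Q (bad T) \<le> \<delta> / (8 * real k)" if "T \<in> P" for T
  proof -
    have "rep T \<in> \<Theta>"
      using rep[OF that] partition_onD1[OF P(2)] that by auto
    then show ?thesis
      unfolding bad_def L_def M_def exp_t[symmetric]
      by (intro empirical_loss_tail n m beta t cond_pos)
  qed
  then have "(\<Sum>T\<in>P. measure_pmf.prob ?Q (bad T)) \<le> (\<Sum>T\<in>P. \<delta> / (8 * real k))"
    by (rule sum_mono)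
  moreover have "measure_pmf.prob ?Q (\<Union>T\<in>P. bad T) \<le> (\<Sum>T\<in>P. measure_pmf.prob ?Q (bad T))"
    using P(1) by (intro measure_pmf.finite_measure_subadditive_finite) auto
  ultimately have bad: "measure_pmf.prob ?Q (\<Union>T\<in>P. bad T) \<le> \<delta> / 8"
    using k \<open>card P = k\<close> by simp

  define bad_tv where "bad_tv = {D. C \<le> tv_dist (emp D) pX}"
  \<comment> \<open>There are \<open>CARD('a) ^ CARD('n)\<close> sequences, and the cube of this
    number is the numerator in \<open>C\<close>.\<close>
  have C: "C = sqrt (real CARD('n \<Rightarrow> 'a) ^ 3 / (8 * \<delta> * real n))"
    by (simp add: C_def card_fun power_mult[symmetric] mult.commute)
  have "0 < C" unfolding C using delta n by simp
  have fst_data: "map_pmf fst (bind_pmf pX (\<lambda>x. map_pmf (Pair x) (Pi_pmf {..<m} undefined (\<lambda>_. pK x)))) = pX"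
    by (simp add: map_bind_pmf map_pmf_comp bind_return_pmf' map_pmf_const)
  have "measure_pmf.prob ?Q bad_tv \<le> (real CARD('n \<Rightarrow> 'a) - 1) / (4 * real n * C\<^sup>2)"
    using empirical_tv_dist_tail[OF n \<open>0 < C\<close>, of undefined
        "bind_pmf pX (\<lambda>x. map_pmf (Pair x) (Pi_pmf {..<m} undefined (\<lambda>_. pK x)))" fst]
    unfolding fst_data bad_tv_def emp_def data_pmf_def .
  also have "\<dots> \<le> \<delta> / 2"
    unfolding C by (intro tv_deviation_bound n delta) simp
  finally have bad_tv: "measure_pmf.prob ?Q bad_tv \<le> \<delta> / 2" .

  define good where "good = - (bad_tv \<union> (\<Union>T\<in>P. bad T))"
  \<comment> \<open>The failure probabilities add up to at most \<open>5 * \<delta> / 8\<close>,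
    which is below \<open>\<delta>\<close>.\<close>
  have "measure_pmf.prob ?Q (bad_tv \<union> (\<Union>T\<in>P. bad T)) \<le> \<delta> / 2 + \<delta> / 8"
    using measure_Un_le[of bad_tv ?Q "\<Union>T\<in>P. bad T"] bad bad_tv by simp
  then have "1 - \<delta> \<le> measure_pmf.prob ?Q good"
    using measure_pmf.prob_compl[of "bad_tv \<union> (\<Union>T\<in>P. bad T)" ?Q] delta
    by (simp add: good_def Compl_eq_Diff_UNIV)
  also have "\<dots> \<le> measure_pmf.prob ?Q {D. tv_dist (p (\<theta>hat D)) pX
      < sqrt (1/2 * C_AT (p (\<theta>hat D)) *
          (empirical_loss pK p n m D (\<theta>hat D) + B * ln (1 / \<beta>) + \<epsilon>)) + C}"
  proof (rule measure_pmf.finite_measure_mono_AE, unfold AE_measure_pmf_iff, intro ballI impI CollectI)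
    fix D assume D: "D \<in> set_pmf ?Q" and "D \<in> good"
    let ?\<theta> = "\<theta>hat D"
    obtain T where T: "T \<in> P" "?\<theta> \<in> T"
      using \<theta>hat[OF D] partition_onD1[OF P(2)] by auto
    have not_bad: "L D (rep T) - t * M < empirical_loss pK p n m D (rep T)"
      using \<open>D \<in> good\<close> T by (auto simp: good_def bad_def)
    \<comment> \<open>Moving to the representative costs \<open>\<epsilon> / 2\<close> in the
      mask-averaged loss, the good event costs \<open>t * M\<close>, and moving back costs another
      \<open>\<epsilon> / 2\<close> in the empirical loss. Closeness is available because all masks
      that occur lie in \<open>\<K>\<close>.\<close>
    have "L D ?\<theta> \<le> (\<Sum>i<n. mask_loss pK (p (rep T)) (fst (D i)) + \<epsilon> / 2) / real n"
      unfolding L_def using masks T rep[OF T(1)]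
      by (intro divide_right_mono sum_mono mask_loss_le_of_log_close close) auto
    also have "\<dots> = L D (rep T) + \<epsilon> / 2"
      using n by (simp add: L_def sum.distrib add_divide_distrib)
    also have "L D (rep T) \<le> empirical_loss pK p n m D (rep T) + t * M"
      using not_bad by simp
    also have "empirical_loss pK p n m D (rep T) \<le> empirical_loss pK p n m D ?\<theta> + \<epsilon> / 2"
      using masks T rep[OF T(1)] set_pmf_data_pmf(2)[OF D]
      by (intro empirical_loss_le_of_log_close n m close) auto
    also have "t * M \<le> B * M"
      using tB M by simp
    finally have L: "L D ?\<theta> \<le> empirical_loss pK p n m D ?\<theta> + B * M + \<epsilon>"
      by simp
    \<comment> \<open>Each sequence in the support of \<open>emp D\<close> occurs in the data and
      hence lies in the support of \<open>pX\<close>, where the margin gives the lower bound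
      \<open>\<beta>\<close>.\<close>
    have pos: "0 < cond_prob pK (p ?\<theta>) K x"
      if x: "x \<in> set_pmf (emp D)" and "K \<in> set_pmf (pK x)" for x K
    proof -
      obtain i where "i < n" "x = fst (D i)"
        using x n by (auto simp: emp_def lessThan_empty_iff)
      then have "x \<in> set_pmf pX" using set_pmf_data_pmf(1)[OF D] by simp
      then show ?thesis
        using cond_pos[OF \<theta>hat[OF D] _ \<open>K \<in> _\<close>] beta by fastforce
    qed
    have "tv_dist (p ?\<theta>) (emp D)
        \<le> sqrt (1 / 2 * C_AT (p ?\<theta>) * (\<Sum>x\<in>UNIV. pmf (emp D) x * mask_loss pK (p ?\<theta>) x))"
      using tensorization[OF D] pos by (rule tv_dist_le_sqrt_mask_loss)
    also have "(\<Sum>x\<in>UNIV. pmf (emp D) x * mask_loss pK (p ?\<theta>) x) = L D ?\<theta>"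
      unfolding emp_def L_def by (rule sum_empirical_pmf[OF n])
    also have "sqrt (1 / 2 * C_AT (p ?\<theta>) * L D ?\<theta>)
        \<le> sqrt (1 / 2 * C_AT (p ?\<theta>) * (empirical_loss pK p n m D ?\<theta> + B * M + \<epsilon>))"
      using tensorization[OF D] L
      by (intro real_sqrt_le_mono mult_left_mono) (auto simp: block_approx_tensorization_def)
    finally have "tv_dist (p ?\<theta>) (emp D)
        \<le> sqrt (1 / 2 * C_AT (p ?\<theta>) * (empirical_loss pK p n m D ?\<theta> + B * ln (1 / \<beta>) + \<epsilon>))"
      by (simp only: M_def)
    \<comment> \<open>The strictness of the final inequality comes from this term.\<close>
    moreover have "tv_dist (emp D) pX < C"
      using \<open>D \<in> good\<close> by (auto simp: good_def bad_tv_def)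
    ultimately show "tv_dist (p ?\<theta>) pX
        < sqrt (1/2 * C_AT (p ?\<theta>) *
            (empirical_loss pK p n m D ?\<theta> + B * ln (1 / \<beta>) + \<epsilon>)) + C"
      using tv_dist_triangle[of "p ?\<theta>" pX "emp D"] by linarith
  qed simp
  finally show ?thesis .
qed

end
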